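(* Let $\mathcal{A}\in\mathbb{R}^{n\times n\times p}$ be a T-SPD tensor, let $d=np$, and let $\lambda_1(\mathcal{A})$ be its largest T-eigenvalue. For any vector $\mathbf{x}_q\in\mathbb{R}^d$ with $\|\mathbf{x}_q\|_2=1$, $$\mathbf{x}_q^{\mathsf T}\,\operatorname{bcirc}(\mathcal{A})\,\mathbf{x}_q\;\le\;\lambda_1(\mathcal{A}).$$ In particular, the output $\hat\lambda_1^{\rm pow}=\mathbf{x}_q^{\mathsf T}\operatorname{bcirc}(\mathcal{A})\mathbf{x}_q$ of the T-product randomized power method applied to $\mathcal{A}$ is always a lower bound on $\lambda_1(\mathcal{A})$.
   Context: For $\mathcal{A}\in\mathbb{R}^{n\times n\times p}$ with frontal slices $\mathcal{A}^{(1)},\dots,\mathcal{A}^{(p)}\in\mathbb{R}^{n\times n}$, $\operatorname{bcirc}(\mathcal{A})\in\mathbb{R}^{np\times np}$ is the block circulant matrix whose $(i,j)$ block ($1\le i,j\le p$) is $\mathcal{A}^{(((i-j)\bmod p)+1)}$. The tensor $\mathcal{A}$ is T-symmetric if $\operatorname{bcirc}(\mathcal{A})$ is symmetric, and T-SPD if $\operatorname{bcirc}(\mathcal{A})$ is symmetric positive definite. The T-eigenvalues of $\mathcal{A}$ are the eigenvalues of $\operatorname{bcirc}(\mathcal{A})$, counted with multiplicity and ordered $\lambda_1\ge\dots\ge\lambda_d$, $d=np$. T-product randomized power method with $q$ iterations: draw $\mathbf{x}_0\sim\mathcal{N}(0,I_d)$ and normalize it to unit Euclidean norm; for $k=1,\dots,q$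 set $\mathbf{y}_k=\operatorname{bcirc}(\mathcal{A})\mathbf{x}_{k-1}$ and $\mathbf{x}_k=\mathbf{y}_k/\|\mathbf{y}_k\|_2$; output $\hat\lambda_1^{\rm pow}=\mathbf{x}_q^{\mathsf T}\operatorname{bcirc}(\mathcal{A})\mathbf{x}_q$. *)

theory Defs
  imports "HOL-Probability.Probability" "Jordan_Normal_Form.Char_Poly"
begin

unbundle no vec_syntax and no inner_syntax

(* A tensor in R^(n x n x p) is the list of its p frontal slices: the slice written
   A^(k) with 1 <= k <= p is the list entry A ! (k - 1). *)

definition tensors :: "nat \<Rightarrow> nat \<Rightarrow> real mat list set" where
  "tensors n p = {A. length A = p \<and> set A \<subseteq> carrier_mat n n}"

(* Row r lies in block row r div n, at position r mod n inside the block, and likewise for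
   columns.  The block indices are 0-based; the block index enters only through the
   difference i - j, and the shift by one of the slice index is absorbed by list indexing.
   The difference is taken in int, where mod p has values in {0..<p}. *)

definition bcirc :: "nat \<Rightarrow> real mat list \<Rightarrow> real mat" where
  "bcirc n A = (let p = length A in
     mat (n * p) (n * p)
       (\<lambda>(r, c). (A ! nat ((int (r div n) - int (c div n)) mod int p)) $$ (r mod n, c mod n)))"

lemma bcirc_carrier: "A \<in> tensors n p \<Longrightarrow> bcirc n A \<in> carrier_mat (n * p) (n * p)"
  by (auto simp: bcirc_def tensors_def Let_def)

definition symmetric_matrix :: "real mat \<Rightarrow> bool" where
  "symmetric_matrix B \<longleftrightarrow> square_mat B \<and> transpose_mat B = B"

definition spd_matrix :: "real mat \<Rightarrow> bool" where
  "spd_matrix B \<longleftrightarrow> symmetric_matrix B \<and>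
     (\<forall>x \<in> carrier_vec (dim_row B). x \<noteq> 0\<^sub>v (dim_row B) \<longrightarrow> scalar_prod x (B *\<^sub>v x) > 0)"

definition T_symmetric :: "nat \<Rightarrow> real mat list \<Rightarrow> bool" where
  "T_symmetric n A \<longleftrightarrow> symmetric_matrix (bcirc n A)"

definition T_SPD :: "nat \<Rightarrow> real mat list \<Rightarrow> bool" where
  "T_SPD n A \<longleftrightarrow> spd_matrix (bcirc n A)"

(* The real roots of the characteristic polynomial with multiplicity, in decreasing order.
   For a T-symmetric tensor these are all the eigenvalues of the block circulant matrix. *)

definition T_eigenvalues :: "nat \<Rightarrow> real mat list \<Rightarrow> real list" where
  "T_eigenvalues n A = rev (sorted_list_of_multiset (proots (char_poly (bcirc n A))))"

lemma set_T_eigenvalues: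
  assumes "A \<in> tensors n p"
  shows "set (T_eigenvalues n A) = {e. eigenvalue (bcirc n A) e}"
proof -
  have "char_poly (bcirc n A) \<noteq> 0"
    using degree_monic_char_poly[OF bcirc_carrier[OF assms]] by auto
  then show ?thesis
    by (simp add: T_eigenvalues_def eigenvalue_root_char_poly[OF bcirc_carrier[OF assms]])
qed

(* T_eigenvalue n A k is lambda_k, with k counted from 1. *)

definition T_eigenvalue :: "nat \<Rightarrow> real mat list \<Rightarrow> nat \<Rightarrow> real" where
  "T_eigenvalue n A k = T_eigenvalues n A ! (k - 1)"

definition euclid_norm :: "real vec \<Rightarrow> real" where
  "euclid_norm x = sqrt (scalar_prod x x)"

(* Since 1 / 0 = 0, the zero vector is mapped to itself. *)

definition normalized :: "real vec \<Rightarrow> real vec" where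
  "normalized x = (1 / euclid_norm x) \<cdot>\<^sub>v x"

fun power_iterate :: "real mat \<Rightarrow> real vec \<Rightarrow> nat \<Rightarrow> real vec" where
  "power_iterate B x0 0 = normalized x0"
| "power_iterate B x0 (Suc k) = normalized (B *\<^sub>v power_iterate B x0 k)"

(* The output of the T-product power method after q iterations as a function of the vector
   drawn at the start. *)

definition T_power_output :: "nat \<Rightarrow> real mat list \<Rightarrow> nat \<Rightarrow> real vec \<Rightarrow> real" where
  "T_power_output n A q x0 = (let x = power_iterate (bcirc n A) x0 q in
     scalar_prod x (bcirc n A *\<^sub>v x))"

(* X is a random vector with distribution N(0, I_d): its d coordinates are independent
   standard normal variables. *)

definition standard_gaussian_vector :: "'w measure \<Rightarrow> nat \<Rightarrow> ('w \<Rightarrow> real vec) \<Rightarrow> bool" where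
  "standard_gaussian_vector M d X \<longleftrightarrow>
     prob_space M \<and>
     (\<forall>\<omega> \<in> space M. X \<omega> \<in> carrier_vec d) \<and>
     prob_space.indep_vars M (\<lambda>_. borel) (\<lambda>i \<omega>. vec_index (X \<omega>) i) {..<d} \<and>
     (\<forall>i<d. distributed M lborel (\<lambda>\<omega>. vec_index (X \<omega>) i)
        (\<lambda>x. ennreal (std_normal_density x)))"

end

theory Submission
  imports Defs
begin

text \<open>
  For a symmetric matrix \<open>B\<close> let \<open>\<mu>\<close> be the least number with \<open>x \<bullet> B x \<le> \<mu> (x \<bullet> x)\<close> for all \<open>x\<close>.
  Then \<open>C = \<mu> I - B\<close> is positive semidefinite, which gives \<open>\<bar>C x\<bar>\<^sup>2 \<le> K (x \<bullet> C x)\<close> for some \<open>K\<close>.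
  If \<open>C\<close> were invertible, it would follow that \<open>x \<bullet> C x \<ge> \<delta> (x \<bullet> x)\<close> for some \<open>\<delta> > 0\<close>, contradicting
  the minimality of \<open>\<mu>\<close>. Hence \<open>\<mu>\<close> is an eigenvalue, and no compactness argument is needed.
  A power iterate is a unit vector, or zero in the degenerate case of a zero initial vector, where
  the bound amounts to \<open>\<lambda>\<^sub>1 \<ge> 0\<close>.
\<close>

section \<open>Real inner products and norm bounds for matrices\<close>

lemma scalar_prod_self_nonneg: "0 \<le> x \<bullet> (x :: real vec)"
  by (auto simp: scalar_prod_def intro: sum_nonneg)

lemma scalar_prod_self_pos:
  assumes "x \<in> carrier_vec d" "x \<noteq> 0\<^sub>v d"
  shows "0 < x \<bullet> (x :: real vec)"
proof -
  have "x \<bullet> x \<noteq> 0"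
  proof
    assume "x \<bullet> x = 0"
    then have "\<forall>i\<in>{0..<dim_vec x}. x $ i * x $ i = 0"
      unfolding scalar_prod_def by (subst (asm) sum_nonneg_eq_0_iff) auto
    then have "x = 0\<^sub>v d"
      using assms(1) by (intro eq_vecI) auto
    with assms(2) show False ..
  qed
  then show ?thesis
    using scalar_prod_self_nonneg[of x] by linarith
qed

lemma scalar_prod_Cauchy_Schwarz:
  assumes "x \<in> carrier_vec d" "y \<in> carrier_vec d"
  shows "(x \<bullet> y)\<^sup>2 \<le> (x \<bullet> x) * (y \<bullet> (y :: real vec))"
  using Cauchy_Schwarz_ineq_sum[of "vec_index x" "vec_index y" "{0..<d}"] assms
  by (simp add: scalar_prod_def power2_eq_square)

lemma mult_mat_vec_bounded:
  assumes B: "(B :: real mat) \<in> carrier_mat m d"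
  obtains K where "0 < K"
    "\<And>x. x \<in> carrier_vec d \<Longrightarrow> (B *\<^sub>v x) \<bullet> (B *\<^sub>v x) \<le> K * (x \<bullet> x)"
proof
  \<comment> \<open>Cauchy-Schwarz in each row produces the squared Frobenius norm. Adding 1 keeps
    the constant positive for the zero matrix too, so that later steps may divide by it.\<close>
  let ?K = "\<Sum>i\<in>{0..<m}. row B i \<bullet> row B i"
  show "0 < 1 + ?K"
    using sum_nonneg[of "{0..<m}" "\<lambda>i. row B i \<bullet> row B i"] scalar_prod_self_nonneg by force
  fix x :: "real vec" assume x: "x \<in> carrier_vec d"
  have "(B *\<^sub>v x) \<bullet> (B *\<^sub>v x) = (\<Sum>i\<in>{0..<m}. (row B i \<bullet> x)\<^sup>2)"
    using B by (simp add: scalar_prod_def[of "B *\<^sub>v x"] power2_eq_square)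
  also have "\<dots> \<le> (\<Sum>i\<in>{0..<m}. (row B i \<bullet> row B i) * (x \<bullet> x))"
    using B x by (intro sum_mono scalar_prod_Cauchy_Schwarz[of _ d]) auto
  also have "\<dots> \<le> (1 + ?K) * (x \<bullet> x)"
    using scalar_prod_self_nonneg[of x] by (simp add: sum_distrib_right distrib_right)
  finally show "(B *\<^sub>v x) \<bullet> (B *\<^sub>v x) \<le> (1 + ?K) * (x \<bullet> x)" .
qed

text \<open>Serves two expansions: of the squared norm of \<open>x - B x\<close>, and of the
  quadratic form of \<open>C\<close> at \<open>x - (1 / K) C x\<close>.\<close>

lemma scalar_prod_minus_smult:
  assumes "x \<in> carrier_vec d" "y \<in> carrier_vec d" "u \<in> carrier_vec d" "v \<in> carrier_vec d"
  shows "(x - t \<cdot>\<^sub>v y) \<bullet> (u - s \<cdot>\<^sub>v v)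
    = x \<bullet> u - s * (x \<bullet> v) - t * (y \<bullet> u) + t * s * (y \<bullet> (v :: real vec))"
  using assms
  by (simp add: scalar_prod_def sum_subtractf sum.distrib sum_distrib_left algebra_simps)

lemma quadratic_form_bounded:
  assumes B: "(B :: real mat) \<in> carrier_mat d d"
  obtains K where "0 < K" "\<And>x. x \<in> carrier_vec d \<Longrightarrow> x \<bullet> (B *\<^sub>v x) \<le> K * (x \<bullet> x)"
proof -
  obtain K where K: "0 < K"
    "\<And>x. x \<in> carrier_vec d \<Longrightarrow> (B *\<^sub>v x) \<bullet> (B *\<^sub>v x) \<le> K * (x \<bullet> x)"
    using mult_mat_vec_bounded[OF B] by blast
  \<comment> \<open>Expanding the squared norm of \<open>x - B x\<close> bounds even twice the form
    by this right-hand side; the factor 2 is given away.\<close>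
  have "x \<bullet> (B *\<^sub>v x) \<le> (1 + K) * (x \<bullet> x)" if x: "x \<in> carrier_vec d" for x
  proof -
    have Bx: "B *\<^sub>v x \<in> carrier_vec d"
      using B x by simp
    have "0 \<le> (x - 1 \<cdot>\<^sub>v (B *\<^sub>v x)) \<bullet> (x - 1 \<cdot>\<^sub>v (B *\<^sub>v x))"
      by (rule scalar_prod_self_nonneg)
    also have "\<dots> = x \<bullet> x - 2 * (x \<bullet> (B *\<^sub>v x)) + (B *\<^sub>v x) \<bullet> (B *\<^sub>v x)"
      using comm_scalar_prod[OF x Bx]
      by (subst scalar_prod_minus_smult[OF x Bx x Bx]) simp
    finally have "2 * (x \<bullet> (B *\<^sub>v x)) \<le> (1 + K) * (x \<bullet> x)"
      using K(2)[OF x] by (simp add: distrib_right)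
    moreover have "0 \<le> (1 + K) * (x \<bullet> x)"
      using K(1) scalar_prod_self_nonneg[of x] by simp
    ultimately show ?thesis by linarith
  qed
  then show thesis
    using that[of "1 + K"] K(1) by simp
qed

section \<open>Coercivity and the largest eigenvalue of a symmetric matrix\<close>

lemma symmetric_psd_nonsingular_coercive:
  assumes C: "(C :: real mat) \<in> carrier_mat d d" "transpose_mat C = C"
    and psd: "\<And>x. x \<in> carrier_vec d \<Longrightarrow> 0 \<le> x \<bullet> (C *\<^sub>v x)"
    and "det C \<noteq> 0"
  obtains \<delta> where "0 < \<delta>" "\<And>x. x \<in> carrier_vec d \<Longrightarrow> \<delta> * (x \<bullet> x) \<le> x \<bullet> (C *\<^sub>v x)"
proof -
  obtain K where K: "0 < K" "\<And>x. x \<in> carrier_vec d \<Longrightarrow> x \<bullet> (C *\<^sub>v x) \<le> K * (x \<bullet> x)"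
    using quadratic_form_bounded[OF C(1)] by blast
  obtain D where D: "D \<in> carrier_mat d d" "D * C = 1\<^sub>m d"
    using det_non_zero_imp_unit[OF C(1) \<open>det C \<noteq> 0\<close>, of "()"]
    by (auto simp: Units_def ring_mat_simps)
  obtain L where L: "0 < L"
    "\<And>x. x \<in> carrier_vec d \<Longrightarrow> (D *\<^sub>v x) \<bullet> (D *\<^sub>v x) \<le> L * (x \<bullet> x)"
    using mult_mat_vec_bounded[OF D(1)] by blast
  \<comment> \<open>With \<open>y = C x\<close>, invertibility bounds \<open>x \<bullet> x\<close>
    by \<open>L * (y \<bullet> y)\<close>, and semidefiniteness bounds \<open>y \<bullet> y\<close>
    by \<open>K * (x \<bullet> y)\<close>. Hence \<delta> = 1 / (L K).\<close>
  have "x \<bullet> x \<le> L * K * (x \<bullet> (C *\<^sub>v x))" if x: "x \<in> carrier_vec d" for x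
  proof -
    define y where "y = C *\<^sub>v x"
    have y: "y \<in> carrier_vec d" and Cy: "C *\<^sub>v y \<in> carrier_vec d"
      using C x by (auto simp: y_def)
    have "x \<bullet> (C *\<^sub>v y) = y \<bullet> y"
      using transpose_vec_mult_scalar[OF C(1) y x] C(2) by (simp add: y_def)
    moreover have "C *\<^sub>v (x - (1 / K) \<cdot>\<^sub>v y) = y - (1 / K) \<cdot>\<^sub>v (C *\<^sub>v y)"
      using C x y by (simp add: mult_minus_distrib_mat_vec mult_mat_vec flip: y_def)
    \<comment> \<open>Semidefiniteness is tested at a gradient step from \<open>x\<close>. With step
      size 1 / K the quadratic term is at most \<open>(1 / K) * (y \<bullet> y)\<close>, half of
      what the linear term subtracts.\<close>
    ultimately have "(x - (1 / K) \<cdot>\<^sub>v y) \<bullet> (C *\<^sub>v (x - (1 / K) \<cdot>\<^sub>v y))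
        = x \<bullet> y - 2 / K * (y \<bullet> y) + (1 / K) * (1 / K) * (y \<bullet> (C *\<^sub>v y))"
      using scalar_prod_minus_smult[OF x y y Cy] by simp
    moreover have "0 \<le> (x - (1 / K) \<cdot>\<^sub>v y) \<bullet> (C *\<^sub>v (x - (1 / K) \<cdot>\<^sub>v y))"
      using x y by (intro psd) simp
    moreover have "(1 / K) * (1 / K) * (y \<bullet> (C *\<^sub>v y)) \<le> (1 / K) * (y \<bullet> y)"
      using K(2)[OF y] K(1) by (simp add: field_simps)
    ultimately have "(1 / K) * (y \<bullet> y) \<le> x \<bullet> y"
      by simp
    then have *: "y \<bullet> y \<le> K * (x \<bullet> y)"
      using K(1) by (simp add: field_simps)
    have "D *\<^sub>v y = x"
      using assoc_mult_mat_vec[OF D(1) C(1) x] D(2) x by (simp add: y_def)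
    then have "x \<bullet> x \<le> L * (y \<bullet> y)"
      using L(2)[OF y] by simp
    also have "\<dots> \<le> L * K * (x \<bullet> y)"
      using * L(1) by simp
    finally show ?thesis
      by (simp add: y_def)
  qed
  then show thesis
    using that[of "1 / (L * K)"] K(1) L(1) by (simp add: field_simps)
qed

text \<open>Takes the place of the spectral theorem: the eigenvalue found is the supremum of the
  Rayleigh quotients.\<close>

lemma symmetric_exists_eigenvalue_ge_quadratic_form:
  assumes B: "(B :: real mat) \<in> carrier_mat d d" "transpose_mat B = B" and "0 < d"
  obtains \<mu> where "eigenvalue B \<mu>"
    "\<And>x. x \<in> carrier_vec d \<Longrightarrow> x \<bullet> (B *\<^sub>v x) \<le> \<mu> * (x \<bullet> x)"
proof -
  define S where "S = {m. \<forall>x \<in> carrier_vec d. x \<bullet> (B *\<^sub>v x) \<le> m * (x \<bullet> x)}"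
  define \<mu> where "\<mu> = Inf S"
  obtain K where K: "K \<in> S"
  proof (rule quadratic_form_bounded[OF B(1)])
    fix K assume "\<And>x. x \<in> carrier_vec d \<Longrightarrow> x \<bullet> (B *\<^sub>v x) \<le> K * (x \<bullet> x)"
    then show thesis
      using that[of K] by (simp add: S_def)
  qed
  have le: "x \<bullet> (B *\<^sub>v x) / (x \<bullet> x) \<le> m"
    if "m \<in> S" "x \<in> carrier_vec d" "x \<noteq> 0\<^sub>v d" for x m
    using that scalar_prod_self_pos[OF that(2,3)] by (auto simp: S_def field_simps)
  \<comment> \<open>The infimum is attained: every Rayleigh quotient is a lower bound of
    \<open>S\<close>, so it is at most \<mu>, and \<mu> itself satisfies the condition defining
    \<open>S\<close>.\<close>
  have upper: "x \<bullet> (B *\<^sub>v x) \<le> \<mu> * (x \<bullet> x)" if x: "x \<in> carrier_vec d" for x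
  proof (cases "x = 0\<^sub>v d")
    case True
    then show ?thesis
      using B(1) by (simp add: scalar_prod_def)
  next
    case False
    then have "x \<bullet> (B *\<^sub>v x) / (x \<bullet> x) \<le> \<mu>"
      unfolding \<mu>_def using K le x by (intro cInf_greatest) auto
    then show ?thesis
      using scalar_prod_self_pos[OF x False] by (simp add: field_simps)
  qed
  \<comment> \<open>Positive dimension provides a nonzero vector, whose Rayleigh quotient bounds
    \<open>S\<close> from below.\<close>
  have bdd: "bdd_below S"
    using le[of _ "unit_vec d 0"] \<open>0 < d\<close> by (intro bdd_belowI) auto
  define C where "C = \<mu> \<cdot>\<^sub>m 1\<^sub>m d - B"
  have "transpose_mat (\<mu> \<cdot>\<^sub>m 1\<^sub>m d) = \<mu> \<cdot>\<^sub>m 1\<^sub>m d"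
    by (intro eq_matI) auto
  then have C: "C \<in> carrier_mat d d" "transpose_mat C = C"
    using B by (simp_all add: C_def transpose_minus[of _ d d] minus_carrier_mat)
  have Cx: "C *\<^sub>v x = \<mu> \<cdot>\<^sub>v x - B *\<^sub>v x" if "x \<in> carrier_vec d" for x
  proof -
    have "(\<mu> \<cdot>\<^sub>m 1\<^sub>m d) *\<^sub>v x = \<mu> \<cdot>\<^sub>v x"
      using that by (intro eq_vecI) auto
    then show ?thesis
      using B(1) that by (simp add: C_def minus_mult_distrib_mat_vec[of _ d d])
  qed
  have xCx: "x \<bullet> (C *\<^sub>v x) = \<mu> * (x \<bullet> x) - x \<bullet> (B *\<^sub>v x)" if "x \<in> carrier_vec d" for x
    using B(1) that by (simp add: Cx scalar_prod_minus_distrib[of _ d])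
  have psd: "0 \<le> x \<bullet> (C *\<^sub>v x)" if "x \<in> carrier_vec d" for x
    using upper[OF that] xCx[OF that] by simp
  have "det C = 0"
  proof (rule ccontr)
    assume "det C \<noteq> 0"
    then obtain \<delta> where \<delta>: "0 < \<delta>"
      "\<And>x. x \<in> carrier_vec d \<Longrightarrow> \<delta> * (x \<bullet> x) \<le> x \<bullet> (C *\<^sub>v x)"
      using symmetric_psd_nonsingular_coercive[OF C psd] by blast
    have "x \<bullet> (B *\<^sub>v x) \<le> (\<mu> - \<delta>) * (x \<bullet> x)" if "x \<in> carrier_vec d" for x
      using \<delta>(2)[OF that] xCx[OF that] by (simp add: left_diff_distrib)
    then have "\<mu> - \<delta> \<in> S"
      by (simp add: S_def)
    then have "\<mu> \<le> \<mu> - \<delta>"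
      using cInf_lower[OF _ bdd] by (simp add: \<mu>_def)
    with \<delta>(1) show False by simp
  qed
  then obtain v where v: "v \<in> carrier_vec d" "v \<noteq> 0\<^sub>v d" "C *\<^sub>v v = 0\<^sub>v d"
    using det_0_iff_vec_prod_zero_field[OF C(1)] by auto
  have "B *\<^sub>v v = \<mu> \<cdot>\<^sub>v v"
  proof (rule eq_vecI)
    fix i assume "i < dim_vec (\<mu> \<cdot>\<^sub>v v)"
    then have "(\<mu> \<cdot>\<^sub>v v - B *\<^sub>v v) $ i = 0" "i < d"
      using v Cx by auto
    then show "(B *\<^sub>v v) $ i = (\<mu> \<cdot>\<^sub>v v) $ i"
      using B(1) v(1) by simp
  qed (use B v in auto)
  then have "eigenvalue B \<mu>"
    using B(1) v by (auto simp: eigenvalue_def eigenvector_def)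
  then show thesis
    using upper that by blast
qed

section \<open>Passage to T-eigenvalues\<close>

lemma eigenvalue_le_T_eigenvalue_1:
  assumes "A \<in> tensors n p" "eigenvalue (bcirc n A) \<mu>"
  shows "\<mu> \<le> T_eigenvalue n A 1"
proof -
  have "sorted (rev (T_eigenvalues n A))"
    by (simp add: T_eigenvalues_def)
  moreover have "\<mu> \<in> set (T_eigenvalues n A)"
    using assms by (simp add: set_T_eigenvalues)
  \<comment> \<open>The list is decreasing, so its head, at index 1 - 1 = 0, dominates every member;
    membership of \<mu> rules out the empty list.\<close>
  ultimately show ?thesis
    unfolding T_eigenvalue_def
    by (cases "T_eigenvalues n A") (auto simp: sorted_append)
qed

text \<open>Some eigenvalue dominates the quadratic form, and \<lambda>_1 dominates that eigenvalue;
  multiplying by \<open>x \<bullet> x\<close> \<ge> 0 preserves the order.\<close>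

lemma rayleigh_quotient_le_T_eigenvalue_1:
  assumes A: "A \<in> tensors n p" and "T_symmetric n A" "1 \<le> n" "1 \<le> p"
    and x: "x \<in> carrier_vec (n * p)"
  shows "x \<bullet> (bcirc n A *\<^sub>v x) \<le> T_eigenvalue n A 1 * (x \<bullet> x)"
proof -
  have sym: "transpose_mat (bcirc n A) = bcirc n A" and d: "0 < n * p"
    using assms by (simp_all add: T_symmetric_def symmetric_matrix_def)
  obtain \<mu> where \<mu>: "eigenvalue (bcirc n A) \<mu>" "x \<bullet> (bcirc n A *\<^sub>v x) \<le> \<mu> * (x \<bullet> x)"
    using symmetric_exists_eigenvalue_ge_quadratic_form[OF bcirc_carrier[OF A] sym d] x by blast
  then show ?thesis
    using mult_right_mono[OF eigenvalue_le_T_eigenvalue_1[OF A \<mu>(1)] scalar_prod_self_nonneg[of x]]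
    by linarith
qed

section \<open>Iterates of the power method\<close>

lemma normalized_carrier: "x \<in> carrier_vec d \<Longrightarrow> normalized x \<in> carrier_vec d"
  by (simp add: normalized_def)

lemma normalized_cases:
  assumes "x \<in> carrier_vec d"
  shows "normalized x = 0\<^sub>v d \<or> normalized x \<bullet> normalized x = 1"
proof (cases "x = 0\<^sub>v d")
  case True
  then have "normalized x = 0\<^sub>v d"
    by (auto simp: normalized_def)
  then show ?thesis ..
next
  case False
  then have "0 < x \<bullet> x"
    using assms by (rule scalar_prod_self_pos[rotated])
  then show ?thesis
    by (simp add: normalized_def euclid_norm_def)
qed

text \<open>Every iterate is a normalization, of \<open>x0\<close> or of \<open>B\<close> times its
  predecessor, so the dichotomy for normalized vectors applies at each stage.\<close>

lemma power_iterate_cases: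
  assumes "B \<in> carrier_mat d d" "x0 \<in> carrier_vec d"
  shows "power_iterate B x0 q \<in> carrier_vec d \<and>
    (power_iterate B x0 q = 0\<^sub>v d \<or> power_iterate B x0 q \<bullet> power_iterate B x0 q = 1)"
proof (induction q)
  case 0
  then show ?case
    using assms(2) normalized_cases[OF assms(2)] normalized_carrier by simp
next
  case (Suc q)
  then have "B *\<^sub>v power_iterate B x0 q \<in> carrier_vec d"
    using assms by simp
  then show ?case
    using normalized_cases normalized_carrier by simp
qed

theorem theorem3p1:
  fixes n p :: nat and A :: "real mat list"
  assumes "n \<ge> 1" and "p \<ge> 1"
    and "A \<in> tensors n p"
    and "T_SPD n A"
  shows "(\<forall>x \<in> carrier_vec (n * p). euclid_norm x = 1 \<longrightarrow>
            scalar_prod x (bcirc n A *\<^sub>v x) \<le> T_eigenvalue n A 1)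
       \<and> (\<forall>(M :: 'w measure) x0 q. standard_gaussian_vector M (n * p) x0 \<longrightarrow>
            (\<forall>\<omega> \<in> space M. T_power_output n A q (x0 \<omega>) \<le> T_eigenvalue n A 1))"
proof -
  let ?B = "bcirc n A"
  note B = bcirc_carrier[OF assms(3)]
  have sym: "T_symmetric n A"
    using assms(4) by (simp add: T_SPD_def T_symmetric_def spd_matrix_def)
  note rayleigh = rayleigh_quotient_le_T_eigenvalue_1[OF assms(3) sym assms(1,2)]
  \<comment> \<open>Positive definiteness at a unit vector, combined with the Rayleigh bound, gives
    \<lambda>_1 > 0.\<close>
  let ?e = "unit_vec (n * p) 0 :: real vec"
  have d: "0 < n * p"
    using assms(1,2) by simp
  have "\<forall>x\<in>carrier_vec (n * p). x \<noteq> 0\<^sub>v (n * p) \<longrightarrow> 0 < x \<bullet> (?B *\<^sub>v x)"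
    using assms(4) B by (simp add: T_SPD_def spd_matrix_def)
  then have "0 < ?e \<bullet> (?B *\<^sub>v ?e)"
    using unit_vec_nonzero[OF d] unit_vec_carrier by blast
  moreover have "?e \<bullet> ?e = 1"
    using d by simp
  ultimately have pos: "0 < T_eigenvalue n A 1"
    using rayleigh[OF unit_vec_carrier, of 0] by (metis less_le_trans mult.right_neutral)
  have "x \<bullet> (?B *\<^sub>v x) \<le> T_eigenvalue n A 1"
    if "x \<in> carrier_vec (n * p)" "euclid_norm x = 1" for x
    using rayleigh[OF that(1)] that(2) by (simp add: euclid_norm_def)
  \<comment> \<open>Pointwise in the start vector: a unit iterate falls under the Rayleigh bound,
    and a zero iterate gives output 0 < \<lambda>_1.\<close>
  moreover have "T_power_output n A q x0 \<le> T_eigenvalue n A 1"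
    if "x0 \<in> carrier_vec (n * p)" for q x0
    using power_iterate_cases[OF B that, of q] rayleigh[of "power_iterate ?B x0 q"] pos
    by (auto simp: T_power_output_def Let_def scalar_prod_def)
  ultimately show ?thesis
    by (auto simp: standard_gaussian_vector_def)
qed

end
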